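(* Let $\mathbb{X}$ be a real Banach space with topological dual $\mathbb{X}^*$ and let $f:\mathbb{X}\to\mathbb{R}\cup\{+\infty\}$ be a lower semicontinuous convex function which is continuous at a point $\bar x\in\mathbb{X}$ with $f(\bar x)=0$. If $\mathbf{0}^*\in\mathrm{int}\,\partial f(\bar x)$, then the following assertions are true: (i) $\bar x$ is a global sharp minimizer of $f$; (ii) $\bar x$ is superstable (for the family of problems $\min_{x\in\mathbb{X}}[f(x)+g(x)]$, $g\in\mathcal{G}_{\bar x}$); (iii) $f$ admits a global error bound at $\bar x$; (iv) there exists $\epsilon>0$ such that every function $\tilde f\in\mathrm{Ptb}(f,\bar x,\epsilon)$ with $\tilde f(\bar x)=0$ admits a local error bound at $\bar x$.
   Context: $\partial f(\bar x)=\{x^*\in\mathbb{X}^*:\ f(x)-f(\bar x)\ge\langle x^*,x-\bar x\rangle\ \forall x\in\mathbb{X}\}$ is the subdifferential of convex analysis, $\mathbf{0}^*$ the null vector of $\mathbb{X}^*$, and the interior is with respect to the dual norm. $B(x,r)$ is the closed ball. Global sharp minimizer: there exists $\sigma>0$ such that $f(x)\ge f(\bar x)+\sigma\|x-\bar x\|$ for all $x\in\mathbb{X}$. $\mathcal{G}_{\bar x}$ is the set of all functions $g:\mathbb{X}\to\mathbb{R}\cup\{\pm\infty\}$ with $|g(\bar x)|<\infty$. The strong slope of $g$ at $\bar x$ is $|\nabla g|(\bar x)=0$ if $\bar x$ is a local minimizer of $g$, and $|\nabla g|(\bar x)=\limsup_{x\to\bar x}\frac{g(\bar x)-g(x)}{\|x-\bar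 x\|}$ otherwise. $\bar x$ is superstable if it is a local minimizer of $f$ and there exists $\epsilon_0>0$ such that $\bar x$ is a local minimizer of $f+g$ for every $g\in\mathcal{G}_{\bar x}$ with $|\nabla g|(\bar x)<\epsilon_0$. Write $[h\le0]=\{x: h(x)\le0\}$, $[r]_+=\max\{r,0\}$, $\mathrm{dist}(x,S)=\inf_{y\in S}\|x-y\|$. A function $h:\mathbb{X}\to\mathbb{R}\cup\{\pm\infty\}$ with $h(\bar x)=0$ admits a local error bound at $\bar x$ if there exist $c>0$, $r>0$ such that $\mathrm{dist}(x,[h\le0])\le c[h(x)]_+$ for all $x\in B(\bar x,r)$; it admits a global error bound at $\bar x$ if for some $c>0$ this inequality holds for all $x\in\mathbb{X}$. $\mathrm{Ptb}(f,\bar x,\epsilon)=\left\{\tilde f\in\mathcal{G}_{\bar x}:\ \limsup_{x\to\bar x}\frac{|\tilde f(x)-f(x)-(\tilde f(\bar x)-f(\bar x))|}{\|x-\bar x\|}\le\epsilon\right\}$. (Values of $f$ and $\tilde f$ near $\bar x$ only matter here, where $f$ is finite. Any fixed convention may be adopted for $(+\infty)+(-\infty)$ in $f+g$.) *)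

theory Defs
  imports "HOL-Analysis.Analysis"
begin

definition lower_semicontinuous :: "('a::topological_space \<Rightarrow> ereal) \<Rightarrow> bool" where
  "lower_semicontinuous f \<longleftrightarrow> (\<forall>x. f x \<le> Liminf (at x) f)"

(* Meant for functions that never take the value -\<infinity>.  For u = 0 or v = 0 the
   inequality is trivial, since 0 * \<infinity> = 0 on ereal. *)
definition convex_ereal :: "('a::real_vector \<Rightarrow> ereal) \<Rightarrow> bool" where
  "convex_ereal f \<longleftrightarrow> (\<forall>x y. \<forall>u\<ge>0. \<forall>v\<ge>0. u + v = 1 \<longrightarrow>
     f (u *\<^sub>R x + v *\<^sub>R y) \<le> ereal u * f x + ereal v * f y)"

definition subdifferential ::
    "('a::real_normed_vector \<Rightarrow> ereal) \<Rightarrow> 'a \<Rightarrow> ('a \<Rightarrow>\<^sub>L real) set" where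
  "subdifferential f xbar =
     {x'. \<forall>x. f x - f xbar \<ge> ereal (blinfun_apply x' (x - xbar))}"

definition global_sharp_minimizer ::
    "('a::real_normed_vector \<Rightarrow> ereal) \<Rightarrow> 'a \<Rightarrow> bool" where
  "global_sharp_minimizer f xbar \<longleftrightarrow>
     (\<exists>\<sigma>::real. \<sigma> > 0 \<and> (\<forall>x. f x \<ge> f xbar + ereal (\<sigma> * norm (x - xbar))))"

definition local_minimizer :: "('a::topological_space \<Rightarrow> ereal) \<Rightarrow> 'a \<Rightarrow> bool" where
  "local_minimizer h xbar \<longleftrightarrow> (\<forall>\<^sub>F x in nhds xbar. h xbar \<le> h x)"

definition perturbations :: "'a \<Rightarrow> ('a \<Rightarrow> ereal) set" where
  "perturbations xbar = {g. \<bar>g xbar\<bar> < \<infinity>}"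

definition strong_slope :: "('a::real_normed_vector \<Rightarrow> ereal) \<Rightarrow> 'a \<Rightarrow> ereal" where
  "strong_slope g xbar =
     (if local_minimizer g xbar then 0
      else Limsup (at xbar) (\<lambda>x. (g xbar - g x) / ereal (norm (x - xbar))))"

(* In f + g the library convention \<infinity> + (-\<infinity>) = \<infinity> applies. *)
definition superstable :: "('a::real_normed_vector \<Rightarrow> ereal) \<Rightarrow> 'a \<Rightarrow> bool" where
  "superstable f xbar \<longleftrightarrow> local_minimizer f xbar \<and>
     (\<exists>\<epsilon>0::real. \<epsilon>0 > 0 \<and>
        (\<forall>g\<in>perturbations xbar. strong_slope g xbar < ereal \<epsilon>0 \<longrightarrow>
           local_minimizer (\<lambda>x. f x + g x) xbar))"

(* Error bounds are only considered for h with h xbar = 0.  Then xbar lies in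
   {y. h y \<le> 0}, so the convention infdist x {} = 0 plays no role. *)
definition local_error_bound :: "('a::real_normed_vector \<Rightarrow> ereal) \<Rightarrow> 'a \<Rightarrow> bool" where
  "local_error_bound h xbar \<longleftrightarrow> h xbar = 0 \<and>
     (\<exists>c r::real. c > 0 \<and> r > 0 \<and>
        (\<forall>x\<in>cball xbar r. ereal (infdist x {y. h y \<le> 0}) \<le> ereal c * max (h x) 0))"

definition global_error_bound :: "('a::real_normed_vector \<Rightarrow> ereal) \<Rightarrow> 'a \<Rightarrow> bool" where
  "global_error_bound h xbar \<longleftrightarrow> h xbar = 0 \<and>
     (\<exists>c::real. c > 0 \<and>
        (\<forall>x. ereal (infdist x {y. h y \<le> 0}) \<le> ereal c * max (h x) 0))"

definition Ptb ::
    "('a::real_normed_vector \<Rightarrow> ereal) \<Rightarrow> 'a \<Rightarrow> real \<Rightarrow> ('a \<Rightarrow> ereal) set" where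
  "Ptb f xbar \<epsilon> = {f' \<in> perturbations xbar.
     Limsup (at xbar)
       (\<lambda>x. \<bar>f' x - f x - (f' xbar - f xbar)\<bar> / ereal (norm (x - xbar))) \<le> ereal \<epsilon>}"

end

theory Submission
  imports Defs
begin

text \<open>The dual ball of radius \<open>\<delta>\<close> around \<open>0\<close> lies in the subdifferential.  By Hahn--Banach some
  functional of norm at most \<open>1\<close> attains \<open>norm (x - xbar)\<close> at \<open>x - xbar\<close>, so multiplying it by
  \<open>\<delta>\<close> and inserting it in the subgradient inequality gives sharpness.  Growth at a positive linear
  rate absorbs every perturbation of smaller slope, which yields the other three assertions.\<close>

section \<open>Sublinear functionals and the Hahn-Banach argument\<close>

definition sublinear :: "('a::real_vector \<Rightarrow> real) \<Rightarrow> bool" where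
  "sublinear p \<longleftrightarrow> (\<forall>x y. p (x + y) \<le> p x + p y) \<and> (\<forall>c\<ge>0. \<forall>x. p (c *\<^sub>R x) = c * p x)"

lemma sublinear_add: "sublinear p \<Longrightarrow> p (x + y) \<le> p x + p y"
  and sublinear_scale: "sublinear p \<Longrightarrow> c \<ge> 0 \<Longrightarrow> p (c *\<^sub>R x) = c * p x"
  by (auto simp: sublinear_def)

lemma sublinear_zero: "sublinear p \<Longrightarrow> p 0 = 0"
  using sublinear_scale[of p 0 0] by simp

lemma sublinear_minus_ge: "sublinear p \<Longrightarrow> - p (- x) \<le> p x"
  using sublinear_add[of p x "- x"] sublinear_zero[of p] by simp

lemma sublinear_norm: "sublinear (norm :: 'a::real_normed_vector \<Rightarrow> real)"
  by (auto simp: sublinear_def norm_triangle_ineq)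

text \<open>Applying the one-sided scaling bound to \<open>inverse c\<close> and
  \<open>c *\<^sub>R x\<close> yields the reverse inequality, so infima can be treated with upper
  estimates alone.\<close>

lemma sublinearI:
  assumes "\<And>x y. p (x + y) \<le> p x + p y"
    and "\<And>c x. c > 0 \<Longrightarrow> p (c *\<^sub>R x) \<le> c * p x"
    and "p 0 = 0"
  shows "sublinear p"
proof -
  have "p (c *\<^sub>R x) = c * p x" if "c \<ge> 0" for c x
  proof (cases "c = 0")
    case False
    with that have c: "c > 0" by simp
    have "p x \<le> inverse c * p (c *\<^sub>R x)"
      using assms(2)[of "inverse c" "c *\<^sub>R x"] c by simp
    with c have "c * p x \<le> p (c *\<^sub>R x)" by (simp add: field_simps)
    with assms(2)[OF c] show ?thesis by (simp add: antisym)
  qed (simp add: assms(3))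
  with assms(1) show ?thesis by (simp add: sublinear_def)
qed

text \<open>This supplies the lower bounds of chains for Zorn's lemma. Scaling passes to any
  pointwise infimum, whereas subadditivity relies on the chain being totally ordered.\<close>

lemma sublinear_INF_chain:
  assumes "C \<noteq> {}"
    and sub: "\<And>q. q \<in> C \<Longrightarrow> sublinear q"
    and chain: "\<And>q r. q \<in> C \<Longrightarrow> r \<in> C \<Longrightarrow> q \<le> r \<or> r \<le> q"
    and bdd: "\<And>x. bdd_below ((\<lambda>q. q x) ` C)"
  shows "sublinear (\<lambda>x. INF q\<in>C. q x)"
proof (rule sublinearI)
  fix x y
  \<comment> \<open>The target is a sum of two separate infima, so \<open>q\<close> and
    \<open>r\<close> must vary independently; the smaller of the two serves as
    \<open>s\<close>.\<close>
  have *: "(INF q\<in>C. q (x + y)) \<le> q x + r y" if qr: "q \<in> C" "r \<in> C" for q r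
  proof -
    obtain s where s: "s \<in> C" "s \<le> q" "s \<le> r"
      using chain[OF qr] qr by blast
    have "(INF q\<in>C. q (x + y)) \<le> s (x + y)"
      by (rule cINF_lower[OF bdd s(1)])
    also have "\<dots> \<le> s x + s y" by (rule sublinear_add[OF sub[OF s(1)]])
    also have "\<dots> \<le> q x + r y"
      using s by (intro add_mono) (auto simp: le_fun_def)
    finally show ?thesis .
  qed
  have "(INF q\<in>C. q (x + y)) - q x \<le> (INF r\<in>C. r y)" if "q \<in> C" for q
    using *[OF that] assms(1) by (intro cINF_greatest) (auto simp: algebra_simps)
  then have "(INF q\<in>C. q (x + y)) - (INF r\<in>C. r y) \<le> (INF q\<in>C. q x)"
    using assms(1) by (intro cINF_greatest) (auto simp: algebra_simps)
  then show "(INF q\<in>C. q (x + y)) \<le> (INF q\<in>C. q x) + (INF q\<in>C. q y)" by simp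
next
  fix c :: real and x assume c: "c > 0"
  have "(INF q\<in>C. q (c *\<^sub>R x)) / c \<le> (INF q\<in>C. q x)"
  proof (rule cINF_greatest[OF assms(1)])
    fix q assume "q \<in> C"
    then have "(INF q\<in>C. q (c *\<^sub>R x)) \<le> q (c *\<^sub>R x)" by (rule cINF_lower[OF bdd])
    also have "\<dots> = c * q x" using sub \<open>q \<in> C\<close> c by (simp add: sublinear_scale)
    finally show "(INF q\<in>C. q (c *\<^sub>R x)) / c \<le> q x" using c by (simp add: field_simps)
  qed
  then show "(INF q\<in>C. q (c *\<^sub>R x)) \<le> c * (INF q\<in>C. q x)" using c by (simp add: field_simps)
next
  have "(\<lambda>q. q 0) ` C = {0}"
    using assms(1) sub by (auto simp: sublinear_zero image_iff)
  then show "(INF q\<in>C. q 0) = 0" by simp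
qed

text \<open>The largest sublinear minorant of \<open>p\<close> whose value at \<open>- a\<close> is at most \<open>- p a\<close>.\<close>

definition tilt :: "('a::real_vector \<Rightarrow> real) \<Rightarrow> 'a \<Rightarrow> 'a \<Rightarrow> real" where
  "tilt p a x = (INF t\<in>{0..}. p (x + t *\<^sub>R a) - t * p a)"

lemma tilt_le:
  assumes "sublinear p" "t \<ge> 0"
  shows "tilt p a x \<le> p (x + t *\<^sub>R a) - t * p a"
  unfolding tilt_def
proof (rule cINF_lower)
  show "bdd_below ((\<lambda>t. p (x + t *\<^sub>R a) - t * p a) ` {0..})"
  proof (rule bdd_belowI2)
    fix t :: real assume "t \<in> {0..}"
    \<comment> \<open>The terms of the infimum need a lower bound free of \<open>t\<close>;
      splitting \<open>t *\<^sub>R a\<close> as \<open>(x + t *\<^sub>R a) + (- x)\<close> gives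
      \<open>- p (- x)\<close>.\<close>
    then have "t * p a = p (t *\<^sub>R a)" using assms by (simp add: sublinear_scale)
    also have "\<dots> \<le> p (x + t *\<^sub>R a) + p (- x)"
      using sublinear_add[OF assms(1), of "x + t *\<^sub>R a" "- x"] by simp
    finally show "- p (- x) \<le> p (x + t *\<^sub>R a) - t * p a" by simp
  qed
qed (use assms in simp)

lemma tilt_greatest:
  "(\<And>t. t \<ge> 0 \<Longrightarrow> u \<le> p (x + t *\<^sub>R a) - t * p a) \<Longrightarrow> u \<le> tilt p a x"
  unfolding tilt_def by (rule cINF_greatest) auto

lemma sublinear_tilt:
  assumes p: "sublinear p"
  shows "sublinear (tilt p a)"
proof (rule sublinearI)
  fix x y
  \<comment> \<open>Parameters \<open>s\<close> for \<open>x\<close> and \<open>t\<close> for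
    \<open>y\<close> combine to the admissible parameter \<open>s + t\<close> for
    \<open>x + y\<close>.\<close>
  have *: "tilt p a (x + y) \<le> (p (x + s *\<^sub>R a) - s * p a) + (p (y + t *\<^sub>R a) - t * p a)"
    if "s \<ge> 0" "t \<ge> 0" for s t
  proof -
    have "tilt p a (x + y) \<le> p ((x + y) + (s + t) *\<^sub>R a) - (s + t) * p a"
      using that by (intro tilt_le[OF p]) simp
    also have "(x + y) + (s + t) *\<^sub>R a = (x + s *\<^sub>R a) + (y + t *\<^sub>R a)"
      by (simp add: algebra_simps)
    also have "p \<dots> \<le> p (x + s *\<^sub>R a) + p (y + t *\<^sub>R a)" by (rule sublinear_add[OF p])
    finally show ?thesis by (simp add: algebra_simps)
  qed
  have "tilt p a (x + y) - (p (x + s *\<^sub>R a) - s * p a) \<le> tilt p a y" if "s \<ge> 0" for s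
    using *[OF that] by (intro tilt_greatest) (simp add: algebra_simps)
  then have "tilt p a (x + y) - tilt p a y \<le> tilt p a x"
    by (intro tilt_greatest) (simp add: algebra_simps)
  then show "tilt p a (x + y) \<le> tilt p a x + tilt p a y" by simp
next
  fix c :: real and x assume c: "c > 0"
  have "tilt p a (c *\<^sub>R x) / c \<le> tilt p a x"
  proof (rule tilt_greatest)
    fix t :: real assume "t \<ge> 0"
    \<comment> \<open>The parameter \<open>c * t\<close> is chosen so that \<open>c\<close> factors
      out of the whole argument of \<open>p\<close>.\<close>
    have "tilt p a (c *\<^sub>R x) \<le> p (c *\<^sub>R x + (c * t) *\<^sub>R a) - (c * t) * p a"
      using c \<open>t \<ge> 0\<close> by (intro tilt_le[OF p]) simp
    also have "c *\<^sub>R x + (c * t) *\<^sub>R a = c *\<^sub>R (x + t *\<^sub>R a)" by (simp add: algebra_simps)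
    also have "p \<dots> = c * p (x + t *\<^sub>R a)" using p c by (simp add: sublinear_scale)
    finally show "tilt p a (c *\<^sub>R x) / c \<le> p (x + t *\<^sub>R a) - t * p a"
      using c by (simp add: field_simps)
  qed
  then show "tilt p a (c *\<^sub>R x) \<le> c * tilt p a x" using c by (simp add: field_simps)
next
  have "tilt p a 0 \<le> 0" using tilt_le[OF p, of 0 a 0] sublinear_zero[OF p] by simp
  moreover have "0 \<le> tilt p a 0"
    using p by (intro tilt_greatest) (simp add: sublinear_scale)
  ultimately show "tilt p a 0 = 0" by simp
qed

lemma tilt_le_self: "sublinear p \<Longrightarrow> tilt p a x \<le> p x"
  using tilt_le[of p 0 a x] by simp

text \<open>At \<open>t = 1\<close> the argument of \<open>p\<close> vanishes. Consequently a linear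
  functional below \<open>tilt p a\<close> is at least \<open>p a\<close> at
  \<open>a\<close>.\<close>

lemma tilt_minus_le: "sublinear p \<Longrightarrow> tilt p a (- a) \<le> - p a"
  using tilt_le[of p 1 a "- a"] by (simp add: sublinear_zero)

text \<open>A pointwise minimal sublinear \<open>m\<close> equals each \<open>tilt m a\<close>, so \<open>m x \<le> m (x + a) - m a\<close>.\<close>

lemma sublinear_dominates_linear:
  assumes p: "sublinear p"
  obtains L where "linear L" "\<And>x. L x \<le> p x"
proof -
  define A where "A = {q. sublinear q \<and> q \<le> p}"
  \<comment> \<open>Zorn's lemma is applied to the reversed order, so its maximal element is a
    minimal sublinear minorant of \<open>p\<close>.\<close>
  have "\<exists>m\<in>A. \<forall>q\<in>A. m \<ge> q \<longrightarrow> q = m"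
  proof (rule predicate_Zorn)
    show "partial_order_on A (relation_of (\<ge>) A)"
      by (rule partial_order_on_relation_ofI) auto
  next
    fix C assume C: "C \<in> Chains (relation_of (\<ge>) A)"
    then have CA: "C \<subseteq> A" by (rule Chains_relation_of)
    have chain: "q \<le> r \<or> r \<le> q" if "q \<in> C" "r \<in> C" for q r
      using C that by (auto simp: Chains_def relation_of_def)
    show "\<exists>u\<in>A. \<forall>q\<in>C. q \<ge> u"
    proof (cases "C = {}")
      case True
      with p show ?thesis by (auto simp: A_def)
    next
      case False
      \<comment> \<open>Every sublinear minorant of \<open>p\<close> is at least
        \<open>- p (- x)\<close> at \<open>x\<close>, a bound independent of
        \<open>q\<close>.\<close>
      have bdd: "bdd_below ((\<lambda>q. q x) ` C)" for x
      proof (rule bdd_belowI2)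
        fix q assume "q \<in> C"
        then have q: "sublinear q" "q (- x) \<le> p (- x)"
          using CA by (auto simp: A_def le_fun_def)
        show "- p (- x) \<le> q x" using sublinear_minus_ge[OF q(1), of x] q(2) by simp
      qed
      define u where "u = (\<lambda>x. INF q\<in>C. q x)"
      have "sublinear u" unfolding u_def
        using CA chain bdd False by (intro sublinear_INF_chain) (auto simp: A_def)
      moreover have le: "u \<le> q" if "q \<in> C" for q
        unfolding u_def le_fun_def using cINF_lower[OF bdd that] by simp
      moreover have "u \<le> p"
        using False CA le by (force simp: A_def intro: order_trans)
      ultimately show ?thesis by (auto simp: A_def)
    qed
  qed
  then obtain m where m: "sublinear m" "m \<le> p"
    and min: "\<And>q. sublinear q \<Longrightarrow> q \<le> p \<Longrightarrow> q \<le> m \<Longrightarrow> q = m"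
    unfolding A_def by blast
  have "tilt m a = m" for a
  proof (rule min)
    show "tilt m a \<le> m" using tilt_le_self[OF m(1)] by (simp add: le_fun_def)
    then show "tilt m a \<le> p" using m(2) by (rule order_trans)
  qed (rule sublinear_tilt[OF m(1)])
  then have add: "m (x + a) = m x + m a" for x a
    using tilt_le[OF m(1), of 1 a x] sublinear_add[OF m(1), of x a] by simp
  have minus: "m (- x) = - m x" for x
    using add[of x "- x"] sublinear_zero[OF m(1)] by simp
  have "m (c *\<^sub>R x) = c * m x" for c x
  proof (cases "c \<ge> 0")
    case False
    \<comment> \<open>Additivity makes \<open>m\<close> odd, which reduces a negative scalar to the
      positive scalar \<open>- c\<close>.\<close>
    then have "m (- ((- c) *\<^sub>R x)) = - ((- c) * m x)"
      using minus sublinear_scale[OF m(1), of "- c" x] by simp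
    then show ?thesis by simp
  qed (rule sublinear_scale[OF m(1)])
  with add have "linear m" by (intro linearI) auto
  with m(2) that show ?thesis by (auto simp: le_fun_def)
qed

text \<open>A linear functional is taken below \<open>tilt norm x0\<close> instead of below
  \<open>norm\<close>: the tilt forces the value at \<open>x0\<close> up to \<open>norm x0\<close>,
  and staying below \<open>norm\<close> still bounds the operator norm by 1.\<close>

lemma norming_functional:
  fixes x0 :: "'a::real_normed_vector"
  obtains L :: "'a \<Rightarrow>\<^sub>L real" where "norm L \<le> 1" "blinfun_apply L x0 = norm x0"
proof -
  have sub: "sublinear (tilt norm x0)" by (rule sublinear_tilt[OF sublinear_norm])
  obtain m where m: "linear m" "\<And>x. m x \<le> tilt norm x0 x"
    using sublinear_dominates_linear[OF sub] by blast
  have le: "m x \<le> norm x" for x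
    using m(2)[of x] tilt_le_self[OF sublinear_norm, of x0 x] by simp
  have bound: "norm (m x) \<le> norm x * 1" for x
    using le[of x] le[of "- x"] linear_neg[OF m(1), of x] by (simp add: abs_le_iff)
  have bl: "bounded_linear m"
    using m(1) bound by (intro bounded_linear_intro[of m 1]) (auto simp: linear_add linear_scale)
  have "norm x0 \<le> m x0"
    using m(2)[of "- x0"] tilt_minus_le[OF sublinear_norm, of x0] linear_neg[OF m(1), of x0]
    by simp
  with le[of x0] have "m x0 = norm x0" by simp
  moreover have "norm (Blinfun m) \<le> 1"
    using bound bl by (intro norm_blinfun_bound) (auto simp: bounded_linear_Blinfun_apply)
  ultimately show ?thesis
    using that[of "Blinfun m"] bl by (simp add: bounded_linear_Blinfun_apply)
qed

section \<open>Sharp minimality and superstability\<close>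

lemma global_sharp_minimizer_if_interior_subdifferential:
  fixes f :: "'a::real_normed_vector \<Rightarrow> ereal"
  assumes fin: "\<bar>f xbar\<bar> \<noteq> \<infinity>" and int: "0 \<in> interior (subdifferential f xbar)"
  shows "global_sharp_minimizer f xbar"
proof -
  obtain \<delta> where \<delta>: "\<delta> > 0" "cball 0 \<delta> \<subseteq> subdifferential f xbar"
    using int by (auto simp: mem_interior_cball)
  have "f x \<ge> f xbar + ereal (\<delta> * norm (x - xbar))" for x
  proof -
    obtain L :: "'a \<Rightarrow>\<^sub>L real" where L: "norm L \<le> 1" "blinfun_apply L (x - xbar) = norm (x - xbar)"
      using norming_functional by blast
    have "\<delta> *\<^sub>R L \<in> cball 0 \<delta>" using L(1) \<delta>(1) by (simp add: mult_left_le)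
    with \<delta>(2) have "f x - f xbar \<ge> ereal (blinfun_apply (\<delta> *\<^sub>R L) (x - xbar))"
      unfolding subdifferential_def by blast
    then have "f x - f xbar \<ge> ereal (\<delta> * norm (x - xbar))"
      using L(2) by (simp add: blinfun.scaleR_left)
    with fin show ?thesis
      by (cases "f xbar"; cases "f x") auto
  qed
  with \<delta>(1) show ?thesis by (auto simp: global_sharp_minimizer_def)
qed

text \<open>The sharpness constant \<sigma> itself serves as the threshold: near
  \<open>xbar\<close>, a perturbation of smaller slope drops by less than \<sigma> times the
  distance, which the growth of \<open>f\<close> compensates.\<close>

lemma superstable_if_global_sharp_minimizer:
  fixes f :: "'a::real_normed_vector \<Rightarrow> ereal"
  assumes "global_sharp_minimizer f xbar"
  shows "superstable f xbar"
proof -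
  obtain \<sigma> where \<sigma>: "\<sigma> > 0" "\<And>x. f x \<ge> f xbar + ereal (\<sigma> * norm (x - xbar))"
    using assms by (auto simp: global_sharp_minimizer_def)
  have min: "f xbar \<le> f x" for x
    using \<sigma>(2)[of x] \<sigma>(1) by (rule_tac order_trans) (auto simp: add_increasing2)
  have "local_minimizer (\<lambda>x. f x + g x) xbar"
    if g: "g \<in> perturbations xbar" "strong_slope g xbar < ereal \<sigma>" for g
  proof (cases "local_minimizer g xbar")
    \<comment> \<open>Here the slope is 0 by definition and provides no quotient bound, so the two
      minimality inequalities are added directly.\<close>
    case True
    then show ?thesis
      unfolding local_minimizer_def by eventually_elim (simp add: add_mono min)
  next
    case False
    with g(2) have "Limsup (at xbar) (\<lambda>x. (g xbar - g x) / ereal (norm (x - xbar))) < ereal \<sigma>"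
      by (simp add: strong_slope_def)
    then have "\<forall>\<^sub>F x in at xbar. (g xbar - g x) / ereal (norm (x - xbar)) < ereal \<sigma>"
      by (rule Limsup_lessD)
    then have "\<forall>\<^sub>F x in nhds xbar. x \<noteq> xbar \<longrightarrow>
        (g xbar - g x) / ereal (norm (x - xbar)) < ereal \<sigma>"
      by (simp add: eventually_at_filter)
    then show ?thesis
      unfolding local_minimizer_def
    proof eventually_elim
      case (elim x)
      show ?case
      proof (cases "x = xbar")
        case False
        define n where "n = norm (x - xbar)"
        have n: "n > 0" using False by (simp add: n_def)
        have 1: "(g xbar - g x) / ereal n < ereal \<sigma>" using elim False by (simp add: n_def)
        have 2: "f xbar + ereal (\<sigma> * n) \<le> f x" using \<sigma>(2) by (simp add: n_def)
        have "\<bar>g xbar\<bar> \<noteq> \<infinity>" using g(1) by (simp add: perturbations_def)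
        \<comment> \<open>Since \<open>g xbar\<close> is finite, a value
          \<open>g x = -\<infinity>\<close> would make the quotient infinite, contradicting
          \<open>1\<close>.\<close>
        with 1 2 n show ?thesis
          by (cases "g xbar"; cases "g x"; cases "f x"; cases "f xbar") (auto simp: field_simps)
      qed simp
    qed
  qed
  moreover have "local_minimizer f xbar" by (simp add: local_minimizer_def min)
  ultimately show ?thesis using \<sigma>(1) unfolding superstable_def by blast
qed

section \<open>Error bounds from linear growth\<close>

text \<open>The point \<open>xbar\<close> belongs to the sublevel set, so the distance to that set
  is at most \<open>norm (x - xbar)\<close>. Growth at rate \<open>1 / c\<close> thus gives an error
  bound with constant \<open>c\<close>, both globally and locally.\<close>

lemma infdist_sublevel_le:
  fixes h :: "'a::real_normed_vector \<Rightarrow> ereal"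
  assumes "h xbar = 0" "c > 0" "ereal (norm (x - xbar) / c) \<le> h x"
  shows "ereal (infdist x {y. h y \<le> 0}) \<le> ereal c * max (h x) 0"
proof -
  have "infdist x {y. h y \<le> 0} \<le> norm (x - xbar)"
    using infdist_le[of xbar "{y. h y \<le> 0}" x] assms(1) by (simp add: dist_norm)
  then have "ereal (infdist x {y. h y \<le> 0}) \<le> ereal c * ereal (norm (x - xbar) / c)"
    using assms(2) by simp
  also have "\<dots> \<le> ereal c * max (h x) 0"
    using assms(2,3) by (intro ereal_mult_left_mono) (auto simp: le_max_iff_disj)
  finally show ?thesis .
qed

lemma global_error_bound_if_global_sharp_minimizer:
  fixes f :: "'a::real_normed_vector \<Rightarrow> ereal"
  assumes "f xbar = 0" "global_sharp_minimizer f xbar"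
  shows "global_error_bound f xbar"
proof -
  obtain \<sigma> where \<sigma>: "\<sigma> > 0" "\<And>x. f x \<ge> ereal (\<sigma> * norm (x - xbar))"
    using assms by (auto simp: global_sharp_minimizer_def)
  have "ereal (infdist x {y. f y \<le> 0}) \<le> ereal (1 / \<sigma>) * max (f x) 0" for x
    using \<sigma> by (intro infdist_sublevel_le[of f xbar]) (auto simp: assms(1) mult.commute)
  with \<sigma>(1) assms(1) show ?thesis
    unfolding global_error_bound_def by (intro conjI exI[of _ "1 / \<sigma>"]) auto
qed

lemma Ptb_local_error_bound_if_global_sharp_minimizer:
  fixes f :: "'a::real_normed_vector \<Rightarrow> ereal"
  assumes "f xbar = 0" "global_sharp_minimizer f xbar"
  shows "\<exists>\<epsilon>>0. \<forall>f'\<in>Ptb f xbar \<epsilon>. f' xbar = 0 \<longrightarrow> local_error_bound f' xbar"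
proof -
  obtain \<sigma> where \<sigma>: "\<sigma> > 0" "\<And>x. f x \<ge> ereal (\<sigma> * norm (x - xbar))"
    using assms by (auto simp: global_sharp_minimizer_def)
  \<comment> \<open>The non-strict bound \<sigma>/4 on the upper limit becomes a strict bound
    \<sigma>/2 on the quotients near \<open>xbar\<close>. Then \<open>f'\<close> keeps growth rate
    \<sigma> - \<sigma>/2 = \<sigma>/2, whence the constant 2/\<sigma>.\<close>
  have "local_error_bound f' xbar" if f': "f' \<in> Ptb f xbar (\<sigma> / 4)" "f' xbar = 0" for f'
  proof -
    have "Limsup (at xbar) (\<lambda>x. \<bar>f' x - f x\<bar> / ereal (norm (x - xbar))) \<le> ereal (\<sigma> / 4)"
      using f' assms(1) by (simp add: Ptb_def)
    also have "\<dots> < ereal (\<sigma> / 2)" using \<sigma>(1) by simp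
    finally have "\<forall>\<^sub>F x in at xbar. \<bar>f' x - f x\<bar> / ereal (norm (x - xbar)) < ereal (\<sigma> / 2)"
      by (rule Limsup_lessD)
    then obtain r where r: "r > 0" "\<And>x. x \<noteq> xbar \<Longrightarrow> dist x xbar \<le> r \<Longrightarrow>
        \<bar>f' x - f x\<bar> / ereal (norm (x - xbar)) < ereal (\<sigma> / 2)"
      unfolding eventually_at_le by auto
    have "ereal (infdist x {y. f' y \<le> 0}) \<le> ereal (2 / \<sigma>) * max (f' x) 0"
      if x: "x \<in> cball xbar r" for x
    proof (rule infdist_sublevel_le[of f' xbar])
      show "ereal (norm (x - xbar) / (2 / \<sigma>)) \<le> f' x"
      proof (cases "x = xbar")
        case False
        define n where "n = norm (x - xbar)"
        have n: "n > 0" using False by (simp add: n_def)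
        have 1: "\<bar>f' x - f x\<bar> / ereal n < ereal (\<sigma> / 2)"
          using r(2)[OF False] x by (simp add: n_def dist_commute)
        have 2: "ereal (\<sigma> * n) \<le> f x" using \<sigma>(2) by (simp add: n_def)
        \<comment> \<open>By \<open>1\<close> the difference is finite, and under the conventions of
          \<open>ereal\<close> this forces both \<open>f' x\<close> and \<open>f x\<close> to be
          finite.\<close>
        show ?thesis
          unfolding n_def[symmetric] using 1 2 n
          by (cases "f' x"; cases "f x") (auto simp: field_simps abs_if split: if_splits)
      qed (simp add: f'(2))
    qed (use \<sigma>(1) f'(2) in simp_all)
    with \<sigma>(1) r(1) f'(2) show ?thesis
      unfolding local_error_bound_def by (intro conjI exI[of _ "2 / \<sigma>"] exI[of _ r]) auto
  qed
  with \<sigma>(1) show ?thesis by (intro exI[of _ "\<sigma> / 4"]) auto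
qed

theorem theorem3:
  fixes f :: "'a::banach \<Rightarrow> ereal" and xbar :: 'a
  assumes "\<And>x. f x \<noteq> -\<infinity>"
    and "lower_semicontinuous f"
    and "convex_ereal f"
    and "isCont f xbar"
    and "f xbar = 0"
    and "0 \<in> interior (subdifferential f xbar)"
  shows "global_sharp_minimizer f xbar
    \<and> superstable f xbar
    \<and> global_error_bound f xbar
    \<and> (\<exists>\<epsilon>::real. \<epsilon> > 0 \<and>
         (\<forall>f'\<in>Ptb f xbar \<epsilon>. f' xbar = 0 \<longrightarrow> local_error_bound f' xbar))"
proof -
  have "global_sharp_minimizer f xbar"
    using assms(5,6) by (intro global_sharp_minimizer_if_interior_subdifferential) auto
  with assms(5) show ?thesis
    using superstable_if_global_sharp_minimizer global_error_bound_if_global_sharp_minimizer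
      Ptb_local_error_bound_if_global_sharp_minimizer by blast
qed

end
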